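(* Let $\widehat E=E+\varepsilon E_0$ and $\widehat F=F+\varepsilon F_0$ be elements of $\mathbb{D}_n^{\rm CM}$. Then $\widehat E\overset{{\rm D}\text{-}\#}{\leq}\widehat F$ (D-sharp partial order) if and only if $\widehat E\overset{{\rm DM}\text{-}\#}{\leq}\widehat F$ (Dual-minus sharp partial order) and $$(F_0-E_0)EE^{\#}=(E-F)E_0E^{\#},\qquad EE^{\#}(F_0-E_0)=E^{\#}E_0(E-F).$$
   Context: $\varepsilon$ is the dual unit: $\varepsilon\neq 0$, $\varepsilon^2=0$, commuting with reals. $\mathbb{D}^{m\times n}$ is the set of $m\times n$ dual matrices $\widehat E=E+\varepsilon E_0$ with $E,E_0\in\mathbb{R}^{m\times n}$, with the obvious addition, multiplication and transpose $\widehat E^{T}=E^T+\varepsilon E_0^T$. The dual Moore-Penrose generalized inverse (DMPGI) of $\widehat E\in\mathbb{D}^{m\times n}$ is the unique $\widehat X\in\mathbb{D}^{n\times m}$, if it exists, with $\widehat E\widehat X\widehat E=\widehat E$, $\widehat X\widehat E\widehat X=\widehat X$, $(\widehat E\widehat X)^T=\widehat E\widehat X$, $(\widehat X\widehat E)^T=\widehat X\widehat E$. The dual group generalized inverse (DGGI) $\widehat E^{\#}$ of $\widehat E\in\mathbb{D}^{n\times n}$ is the $\widehat X\in\mathbb{D}^{n\times n}$, if it exists, with $\widehat E\widehat X\widehat E=\widehat E$, $\widehat X\widehat E\widehat X=\widehat X$, $\widehat E\widehat X=\widehat X\widehat E$. $\mathbb{D}_n^{\rm CM}$ is the set of dual matrices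 in $\mathbb{D}^{n\times n}$ of dual index one, i.e. (equivalently) those whose DGGI exists; for $\widehat E=E+\varepsilon E_0\in\mathbb{D}_n^{\rm CM}$ the DMPGI of $\widehat E$ exists, and the ordinary group inverse $E^{\#}$ of the real matrix $E$ (the unique $X$ with $EXE=E$, $XEX=X$, $EX=XE$) exists. Sharp partial order: for real $n\times n$ group invertible matrices $E,F$, $E\overset{\#}{\leq}F$ means $EF=E^2=FE$. Dual-minus sharp partial order: for $\widehat E,\widehat F\in\mathbb{D}_n^{\rm CM}$, $\widehat E\overset{{\rm DM}\text{-}\#}{\leq}\widehat F$ means that $E\overset{\#}{\leq}F$ and the DMPGI of $\widehat F-\widehat E$ exists. D-sharp partial order: for $\widehat E,\widehat F\in\mathbb{D}_n^{\rm CM}$, $\widehat E\overset{{\rm D}\text{-}\#}{\leq}\widehat F$ means $\widehat E^{\#}\widehat E=\widehat E^{\#}\widehat F$ and $\widehat E\widehat E^{\#}=\widehat F\widehat E^{\#}$. *)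

theory Defs
  imports "HOL-Analysis.Analysis"
begin

datatype dual = Dual (std_part: real) (dual_part: real)

instantiation dual :: comm_ring_1
begin

definition zero_dual where "0 = Dual 0 0"
definition one_dual where "1 = Dual 1 0"
definition plus_dual where
  "a + b = Dual (std_part a + std_part b) (dual_part a + dual_part b)"
definition minus_dual where
  "a - b = Dual (std_part a - std_part b) (dual_part a - dual_part b)"
definition uminus_dual where
  "- a = Dual (- std_part a) (- dual_part a)"
definition times_dual where
  "a * b = Dual (std_part a * std_part b)
                (std_part a * dual_part b + dual_part a * std_part b)"

instance
  by standard
    (simp_all add: zero_dual_def one_dual_def plus_dual_def minus_dual_def
      uminus_dual_def times_dual_def algebra_simps)

end

definition dual_unit :: dual where "dual_unit = Dual 0 1"

lemma dual_unit: "dual_unit \<noteq> 0" "dual_unit * dual_unit = 0"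
  by (simp_all add: dual_unit_def zero_dual_def times_dual_def)

lemma Dual_eq: "Dual a b = Dual a 0 + dual_unit * Dual b 0"
  by (simp add: dual_unit_def plus_dual_def times_dual_def)

text \<open>
  Dual matrices are matrices over the ring of dual numbers, with the library operations on
  \<^typ>\<open>dual ^ 'n ^ 'm\<close> (an m by n matrix). \<open>dual_matrix E E0\<close> is $E + \varepsilon E_0$;
  every dual matrix has this form for unique real matrices.
\<close>

definition dual_matrix :: "real ^ 'n ^ 'm \<Rightarrow> real ^ 'n ^ 'm \<Rightarrow> dual ^ 'n ^ 'm" where
  "dual_matrix E E0 = (\<chi> i j. Dual (E $ i $ j) (E0 $ i $ j))"

definition std_matrix :: "dual ^ 'n ^ 'm \<Rightarrow> real ^ 'n ^ 'm" where
  "std_matrix A = (\<chi> i j. std_part (A $ i $ j))"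

lemma std_matrix_dual_matrix [simp]: "std_matrix (dual_matrix E E0) = E"
  by (simp add: std_matrix_def dual_matrix_def vec_eq_iff)

lemma dual_matrix_eq_iff: "dual_matrix E E0 = dual_matrix F F0 \<longleftrightarrow> E = F \<and> E0 = F0"
  by (auto simp: dual_matrix_def vec_eq_iff)

lemma dual_matrix_cases: obtains E E0 where "A = dual_matrix E E0"
proof
  show "A = dual_matrix (std_matrix A) (\<chi> i j. dual_part (A $ i $ j))"
    by (simp add: std_matrix_def dual_matrix_def vec_eq_iff)
qed

lemma dual_matrix_add:
  "dual_matrix A A0 + dual_matrix B B0 = dual_matrix (A + B) (A0 + B0)"
  by (simp add: dual_matrix_def vec_eq_iff plus_dual_def)

lemma dual_matrix_diff:
  "dual_matrix A A0 - dual_matrix B B0 = dual_matrix (A - B) (A0 - B0)"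
  by (simp add: dual_matrix_def vec_eq_iff minus_dual_def)

lemma dual_sum: "sum f S = Dual (\<Sum>k\<in>S. std_part (f k)) (\<Sum>k\<in>S. dual_part (f k))"
  by (induction S rule: infinite_finite_induct) (simp_all add: zero_dual_def plus_dual_def)

lemma dual_matrix_mult:
  "dual_matrix A A0 ** dual_matrix B B0 = dual_matrix (A ** B) (A ** B0 + A0 ** B)"
  by (simp add: dual_matrix_def matrix_matrix_mult_def vec_eq_iff dual_sum times_dual_def
      sum.distrib)

lemma dual_matrix_transpose:
  "transpose (dual_matrix A A0) = dual_matrix (transpose A) (transpose A0)"
  by (simp add: dual_matrix_def transpose_def vec_eq_iff)

text \<open>
  Generalized inverses over an arbitrary commutative ring: over \<^typ>\<open>dual\<close> these are the
  DMPGI and the DGGI, over \<^typ>\<open>real\<close> the ordinary Moore-Penrose and group inverse.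
\<close>

definition is_MP_inverse :: "'a::comm_ring_1 ^ 'n ^ 'm \<Rightarrow> 'a ^ 'm ^ 'n \<Rightarrow> bool" where
  "is_MP_inverse A X \<longleftrightarrow>
     A ** X ** A = A \<and> X ** A ** X = X \<and>
     transpose (A ** X) = A ** X \<and> transpose (X ** A) = X ** A"

definition MP_invertible :: "'a::comm_ring_1 ^ 'n ^ 'm \<Rightarrow> bool" where
  "MP_invertible A \<longleftrightarrow> (\<exists>X. is_MP_inverse A X)"

definition is_group_inverse :: "'a::comm_ring_1 ^ 'n ^ 'n \<Rightarrow> 'a ^ 'n ^ 'n \<Rightarrow> bool" where
  "is_group_inverse A X \<longleftrightarrow> A ** X ** A = A \<and> X ** A ** X = X \<and> A ** X = X ** A"

definition group_invertible :: "'a::comm_ring_1 ^ 'n ^ 'n \<Rightarrow> bool" where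
  "group_invertible A \<longleftrightarrow> (\<exists>X. is_group_inverse A X)"

definition group_inverse :: "'a::comm_ring_1 ^ 'n ^ 'n \<Rightarrow> 'a ^ 'n ^ 'n" where
  "group_inverse A = (THE X. is_group_inverse A X)"

lemma is_group_inverse_unique:
  assumes "is_group_inverse A X" "is_group_inverse A Y"
  shows "X = Y"
proof -
  have X: "A ** X ** A = A" "X ** A ** X = X" "A ** X = X ** A"
    and Y: "A ** Y ** A = A" "Y ** A ** Y = Y" "A ** Y = Y ** A"
    using assms by (auto simp: is_group_inverse_def)
  have "A ** X = Y ** A ** (A ** X)"
    using Y X by (metis matrix_mul_assoc)
  also have "\<dots> = Y ** A"
    using X by (metis matrix_mul_assoc)
  finally have AX: "A ** X = A ** Y"
    using Y by simp
  have "X = X ** (A ** X)"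
    using X by (metis matrix_mul_assoc)
  also have "\<dots> = A ** X ** Y"
    using AX X by (metis matrix_mul_assoc)
  also have "\<dots> = Y"
    using AX Y by metis
  finally show ?thesis .
qed

lemma group_inverse_eqI: "is_group_inverse A X \<Longrightarrow> group_inverse A = X"
  unfolding group_inverse_def by (blast intro: is_group_inverse_unique)

lemma is_group_inverse_group_inverse:
  "group_invertible A \<Longrightarrow> is_group_inverse A (group_inverse A)"
  using group_inverse_eqI by (fastforce simp: group_invertible_def)

text \<open>
  The dual matrices of dual index one, which are exactly those possessing a DGGI.
\<close>

definition dual_CM :: "(dual ^ 'n ^ 'n) set" where
  "dual_CM = {A. group_invertible A}"

definition sharp_le :: "real ^ 'n ^ 'n \<Rightarrow> real ^ 'n ^ 'n \<Rightarrow> bool" where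
  "sharp_le E F \<longleftrightarrow>
     group_invertible E \<and> group_invertible F \<and> E ** F = E ** E \<and> E ** E = F ** E"

definition DM_sharp_le :: "dual ^ 'n ^ 'n \<Rightarrow> dual ^ 'n ^ 'n \<Rightarrow> bool" where
  "DM_sharp_le A B \<longleftrightarrow>
     A \<in> dual_CM \<and> B \<in> dual_CM \<and>
     sharp_le (std_matrix A) (std_matrix B) \<and> MP_invertible (B - A)"

definition D_sharp_le :: "dual ^ 'n ^ 'n \<Rightarrow> dual ^ 'n ^ 'n \<Rightarrow> bool" where
  "D_sharp_le A B \<longleftrightarrow>
     A \<in> dual_CM \<and> B \<in> dual_CM \<and>
     group_inverse A ** A = group_inverse A ** B \<and>
     A ** group_inverse A = B ** group_inverse A"

end

theory Submission
  imports Defs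
begin

text \<open>
  For matrices of dual index one, the D-sharp order says that $A^2 = AB = BA$; comparing the two
  components of these equations gives the stated identities. The existence of the DMPGI of
  $B - A$ comes from two facts: $B^\# - A^\#$ is a group inverse of $B - A$, and over the
  dual numbers every matrix with an inner inverse has a Moore-Penrose inverse. For the latter,
  Kaplansky's formula turns an idempotent $e$ into the symmetric idempotent $e e^T z^{-1}$ with the
  same range, where $z = 1 + (e - e^T)(e - e^T)^T$ is invertible because its standard part is
  positive definite. Conversely, $AXA = A$ forces $(1 - EE^\#) E_0 (1 - EE^\#) = 0$, so that no
  information is lost by the multiplications with $EE^\#$ in the identities.
\<close>

section \<open>Bilinearity of matrix products and additivity of transposition\<close>

lemma matrix_add_rdistrib: "(A + B) ** C = A ** C + B ** C"
  for A :: "'a::comm_ring_1 ^ 'n ^ 'm"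
  by (simp add: matrix_matrix_mult_def vec_eq_iff distrib_right sum.distrib)

lemma matrix_diff_ldistrib: "A ** (B - C) = A ** B - A ** C"
  for A :: "'a::comm_ring_1 ^ 'n ^ 'm"
  using matrix_add_ldistrib[of A "B - C" C] by (simp add: algebra_simps)

lemma matrix_diff_rdistrib: "(A - B) ** C = A ** C - B ** C"
  for A :: "'a::comm_ring_1 ^ 'n ^ 'm"
  using matrix_add_rdistrib[of "A - B" B C] by (simp add: algebra_simps)

lemma transpose_add: "transpose (A + B) = transpose A + transpose B"
  for A :: "'a::comm_ring_1 ^ 'n ^ 'm"
  by (simp add: transpose_def vec_eq_iff)

lemma transpose_diff: "transpose (A - B) = transpose A - transpose B"
  for A :: "'a::comm_ring_1 ^ 'n ^ 'm"
  by (simp add: transpose_def vec_eq_iff)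

lemma matrix_mult_zero: "A ** 0 = 0" "0 ** B = 0"
  for A :: "'a::comm_ring_1 ^ 'n ^ 'm"
  by (simp_all add: matrix_matrix_mult_def vec_eq_iff)

lemmas matrix_distribs =
  matrix_add_ldistrib matrix_add_rdistrib matrix_diff_ldistrib matrix_diff_rdistrib

section \<open>Invertibility of \<open>1 + S S^T\<close> over the reals and the dual numbers\<close>

lemma invertible_mat_1_plus_gram:
  fixes S :: "real ^ 'n ^ 'm"
  shows "invertible (mat 1 + S ** transpose S)"
proof -
  have "x = 0" if "(mat 1 + S ** transpose S) *v x = 0" for x
  proof -
    \<comment> \<open>The quadratic form at \<open>x\<close> is |x|^2 + |S^T x|^2, so the kernel is
      trivial.\<close>
    have "0 = x \<bullet> ((mat 1 + S ** transpose S) *v x)"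
      using that by simp
    also have "\<dots> = x \<bullet> x + x \<bullet> (S *v (transpose S *v x))"
      by (simp add: matrix_vector_mult_add_rdistrib inner_add_right
          flip: matrix_vector_mul_assoc del: transpose_matrix_vector)
    also have "\<dots> = x \<bullet> x + (transpose S *v x) \<bullet> (transpose S *v x)"
      by (simp flip: dot_lmul_matrix)
    finally show "x = 0"
      by (metis add_nonneg_eq_0_iff inner_eq_zero_iff inner_ge_zero)
  qed
  then show ?thesis
    by (simp add: invertible_left_inverse matrix_left_invertible_ker)
qed

lemma mat_1_dual: "mat 1 = dual_matrix (mat 1) 0"
  by (simp add: dual_matrix_def mat_def vec_eq_iff one_dual_def zero_dual_def)

text \<open>The inverse is the Neumann series \<open>W - \<epsilon> W Z0 W\<close>, which stops
  there because \<epsilon>^2 = 0.\<close>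

lemma invertible_dual_matrix:
  assumes "invertible Z"
  shows "invertible (dual_matrix Z Z0)"
proof -
  obtain W where W: "Z ** W = mat 1" "W ** Z = mat 1"
    using assms by (auto simp: invertible_def)
  have V: "Z ** (0 - W ** Z0 ** W) + Z0 ** W = 0"
    "W ** Z0 + (0 - W ** Z0 ** W) ** Z = 0"
    by (simp_all only: matrix_distribs matrix_mul_assoc W)
      (simp_all add: W flip: matrix_mul_assoc)
  show ?thesis
    unfolding invertible_def mat_1_dual
    by (rule exI[of _ "dual_matrix W (0 - W ** Z0 ** W)"])
      (use V in \<open>simp add: dual_matrix_mult dual_matrix_eq_iff W\<close>)
qed

lemma invertible_dual_mat_1_plus_gram:
  fixes S :: "dual ^ 'n ^ 'm"
  shows "invertible (mat 1 + S ** transpose S)"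
proof -
  obtain P Q where "S = dual_matrix P Q"
    by (rule dual_matrix_cases)
  then show ?thesis
    by (simp add: mat_1_dual dual_matrix_transpose dual_matrix_mult dual_matrix_add
        invertible_dual_matrix invertible_mat_1_plus_gram)
qed

section \<open>Symmetric idempotents and Moore-Penrose inverses\<close>

lemma orthogonal_projection_of_idempotent:
  fixes e :: "'a::comm_ring_1 ^ 'n ^ 'n"
  assumes e: "e ** e = e"
    and inv: "invertible (mat 1 + (e - transpose e) ** transpose (e - transpose e))"
  obtains p where "transpose p = p" "e ** p = p" "p ** e = e"
proof -
  let ?t = "transpose e"
  define z where "z = mat 1 + (e - ?t) ** transpose (e - ?t)"
  obtain w where w: "z ** w = mat 1" "w ** z = mat 1"
    using inv by (auto simp: invertible_def z_def)
  have e': "e ** (e ** x) = e ** x" for x :: "'a ^ 'n ^ 'n"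
    by (simp add: e matrix_mul_assoc)
  have t: "?t ** ?t = ?t"
    by (metis e matrix_transpose_mul)
  \<comment> \<open>The terms of z linear in e and its transpose cancel against the rest, so z, and
    with it the inverse w, commutes with e.\<close>
  have ez: "e ** z = e ** ?t ** e" and ze: "z ** e = e ** ?t ** e"
    unfolding z_def
    by (simp_all add: transpose_diff transpose_transpose matrix_distribs e e' t
        flip: matrix_mul_assoc)
  have tz: "transpose z = z"
    by (simp add: z_def transpose_add matrix_transpose_mul transpose_transpose)
  have tw: "transpose w = w"
    by (metis w tz matrix_mul_assoc matrix_mul_lid matrix_mul_rid matrix_transpose_mul
        transpose_mat)
  have ew: "e ** w = w ** e"
    by (metis ez ze w matrix_mul_assoc matrix_mul_lid matrix_mul_rid)
  have tew: "?t ** w = w ** ?t"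
    by (metis ew tw matrix_transpose_mul)
  \<comment> \<open>The three laws also make p idempotent: p p = p e p = e p = p.\<close>
  show thesis
  proof
    show "transpose (e ** ?t ** w) = e ** ?t ** w"
      by (simp add: matrix_transpose_mul transpose_transpose tw)
        (metis ew tew matrix_mul_assoc)
    show "e ** (e ** ?t ** w) = e ** ?t ** w"
      by (simp add: e matrix_mul_assoc)
    show "e ** ?t ** w ** e = e"
      by (metis ew ez w matrix_mul_assoc matrix_mul_rid)
  qed
qed

text \<open>The idempotents \<open>C ** Z\<close> and \<open>Z ** C\<close> are replaced by
  symmetric ones, p with the range of the first and q with the kernel of the second. Then
  \<open>q ** Z ** p\<close> has products p and q with C.\<close>

lemma MP_invertible_dualI:
  fixes C :: "dual ^ 'n ^ 'm"
  assumes C: "C ** Z ** C = C"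
  shows "MP_invertible C"
proof -
  have "(C ** Z) ** (C ** Z) = C ** Z"
    by (simp add: C matrix_mul_assoc)
  then obtain p where p: "transpose p = p" "C ** Z ** p = p" "p ** (C ** Z) = C ** Z"
    by (rule orthogonal_projection_of_idempotent[OF _ invertible_dual_mat_1_plus_gram])
  \<comment> \<open>Transposing turns the common range provided by the projection lemma into a
    common kernel.\<close>
  have "transpose (Z ** C) ** transpose (Z ** C) = transpose (Z ** C)"
    by (metis C matrix_mul_assoc matrix_transpose_mul)
  then obtain q where q: "transpose q = q" "transpose (Z ** C) ** q = q"
    "q ** transpose (Z ** C) = transpose (Z ** C)"
    by (rule orthogonal_projection_of_idempotent[OF _ invertible_dual_mat_1_plus_gram])
  have q': "q ** (Z ** C) = q" "Z ** C ** q = Z ** C"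
    by (metis q matrix_transpose_mul transpose_transpose)+
  have Cq: "C ** q = C"
    by (metis C q'(2) matrix_mul_assoc)
  have pC: "p ** C = C"
    by (metis C p(3) matrix_mul_assoc)
  have CX: "C ** (q ** Z ** p) = p"
    by (metis Cq p(2) matrix_mul_assoc)
  have XC: "q ** Z ** p ** C = q"
    by (metis pC q'(1) matrix_mul_assoc)
  have qq: "q ** q = q"
    by (metis q' matrix_mul_assoc)
  have "is_MP_inverse C (q ** Z ** p)"
    unfolding is_MP_inverse_def CX XC by (simp add: p(1) q(1) pC qq matrix_mul_assoc)
  then show ?thesis
    by (auto simp: MP_invertible_def)
qed

section \<open>Group inverses and the equations \<open>A ** A = A ** B = B ** A\<close>\<close>

lemma group_inverse_absorb:
  assumes "is_group_inverse A X"
  shows "A ** (A ** X) = A" "X ** A ** A = A" "X ** (X ** A) = X" "A ** X ** X = X"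
  using assms unfolding is_group_inverse_def by (metis matrix_mul_assoc)+

text \<open>Multiplication by A^2 on the side of the group inverse X removes X; multiplication by
  X^2 brings it back.\<close>

lemma D_sharp_le_iff:
  assumes "A \<in> dual_CM" "B \<in> dual_CM"
  shows "D_sharp_le A B \<longleftrightarrow> A ** A = A ** B \<and> A ** A = B ** A"
proof -
  define X where "X = group_inverse A"
  have X: "is_group_inverse A X"
    using assms is_group_inverse_group_inverse by (auto simp: X_def dual_CM_def)
  note X' = group_inverse_absorb[OF X]
  have XA: "A ** X = X ** A"
    using X by (simp add: is_group_inverse_def)
  have "X ** A = X ** B \<longleftrightarrow> A ** A = A ** B"
    by (metis X' XA matrix_mul_assoc)
  moreover have "A ** X = B ** X \<longleftrightarrow> A ** A = B ** A"
    by (metis X' XA matrix_mul_assoc)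
  ultimately show ?thesis
    using assms by (auto simp: D_sharp_le_def X_def)
qed

text \<open>The idempotent \<open>A ** X\<close> splits B into the blocks A and B - A, and
  correspondingly Y into X and Y - X. The inner-inverse law is the form that
  \<open>MP_invertible_dualI\<close> takes.\<close>

lemma inner_inverse_diff:
  fixes A B :: "'a::comm_ring_1 ^ 'n ^ 'n"
  assumes X: "is_group_inverse A X" and Y: "is_group_inverse B Y"
    and AB: "A ** A = A ** B" and BA: "A ** A = B ** A"
  shows "(B - A) ** (Y - X) ** (B - A) = B - A"
proof -
  note X' = group_inverse_absorb[OF X] and Y' = group_inverse_absorb[OF Y]
  have XA: "A ** X = X ** A" and YB: "B ** Y = Y ** B" and BYB: "B ** Y ** B = B"
    using X Y by (auto simp: is_group_inverse_def)
  have BX: "B ** X = A ** X"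
    by (metis BA X'(4) matrix_mul_assoc)
  have XB: "X ** B = X ** A"
    by (metis AB X'(3) XA matrix_mul_assoc)
  have A_XAB: "X ** A ** B = A"
    by (metis AB X'(2) matrix_mul_assoc)
  have BYA: "B ** Y ** A = A"
    by (metis BA BYB X'(1) matrix_mul_assoc)
  have ABY: "A ** B ** Y = A"
    by (metis A_XAB AB BYB YB matrix_mul_assoc)
  have AY: "A ** Y = A ** X"
    by (metis AB ABY X'(2) XA matrix_mul_assoc)
  \<comment> \<open>As B X = A Y = A X, the first product is B Y - A X; times B - A it leaves B - A
    - A + A.\<close>
  show ?thesis
    by (simp add: matrix_distribs BX AY BYB BYA XA A_XAB X')
qed

text \<open>The dual part of A X A = A writes E0 as a sum of a term starting with E and one ending
  with E; 1 - E G annihilates E from both sides.\<close>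

lemma group_inverse_std_dual:
  assumes "dual_matrix E E0 \<in> dual_CM"
  obtains G where "is_group_inverse E G" "(mat 1 - E ** G) ** E0 ** (mat 1 - E ** G) = 0"
proof -
  obtain X where X: "is_group_inverse (dual_matrix E E0) X"
    using assms by (auto simp: dual_CM_def group_invertible_def)
  obtain G G0 where G: "X = dual_matrix G G0"
    by (rule dual_matrix_cases)
  have std: "E ** G ** E = E" "G ** E ** G = G" "E ** G = G ** E"
    and E0: "E ** G ** E0 + (E ** G0 + E0 ** G) ** E = E0"
    using X by (auto simp: is_group_inverse_def G dual_matrix_mult dual_matrix_eq_iff)
  show thesis
  proof
    show G': "is_group_inverse E G"
      using std by (simp add: is_group_inverse_def)
    let ?N = "mat 1 - E ** G"
    have NE: "?N ** E = 0"
      by (simp add: matrix_distribs std(1))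
    have EN: "E ** ?N = 0"
      by (simp add: matrix_distribs group_inverse_absorb[OF G'])
    have NEx: "?N ** (E ** V) = 0" for V :: "real ^ 'a ^ 'a"
      by (simp add: NE matrix_mul_assoc)
    have "?N ** E0 ** ?N = ?N ** (E ** G ** E0 + (E ** G0 + E0 ** G) ** E) ** ?N"
      by (simp only: E0)
    also have "\<dots> = ?N ** (E ** (G ** E0)) ** ?N + ?N ** (E ** G0 + E0 ** G) ** (E ** ?N)"
      by (simp only: matrix_add_ldistrib matrix_add_rdistrib matrix_mul_assoc)
    finally show "?N ** E0 ** ?N = 0"
      by (simp add: NEx EN)
  qed
qed

theorem theorem4p6:
  fixes E E0 F F0 :: "real ^ 'n ^ 'n"
  assumes "dual_matrix E E0 \<in> dual_CM"
    and "dual_matrix F F0 \<in> dual_CM"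
  shows "D_sharp_le (dual_matrix E E0) (dual_matrix F F0) \<longleftrightarrow>
      DM_sharp_le (dual_matrix E E0) (dual_matrix F F0) \<and>
      (F0 - E0) ** E ** group_inverse E = (E - F) ** E0 ** group_inverse E \<and>
      E ** group_inverse E ** (F0 - E0) = group_inverse E ** E0 ** (E - F)"
    (is "?D \<longleftrightarrow> ?DM \<and> ?R \<and> ?L")
proof -
  let ?A = "dual_matrix E E0" and ?B = "dual_matrix F F0"
  obtain G where G: "is_group_inverse E G"
    and N: "(mat 1 - E ** G) ** E0 ** (mat 1 - E ** G) = 0"
    using assms(1) by (rule group_inverse_std_dual)
  have F: "group_invertible F"
    using assms(2) by (metis group_inverse_std_dual group_invertible_def)
  have GE: "group_inverse E = G"
    using G by (rule group_inverse_eqI)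
  note G' = group_inverse_absorb[OF G]
  have EG: "E ** G = G ** E"
    using G by (simp add: is_group_inverse_def)
  \<comment> \<open>The dual part of A A = A B is E E0 + E0 E = E F0 + E0 F; A A = B A gives the
    mirror image.\<close>
  have D: "?D \<longleftrightarrow> E ** E = E ** F \<and> E ** E = F ** E \<and>
      E ** (F0 - E0) = E0 ** (E - F) \<and> (F0 - E0) ** E = (E - F) ** E0"
    unfolding D_sharp_le_iff[OF assms] dual_matrix_mult dual_matrix_eq_iff
    by (auto simp: matrix_distribs algebra_simps)
  show ?thesis
  proof
    assume ?D
    then have AB: "?A ** ?A = ?A ** ?B" "?A ** ?A = ?B ** ?A"
      using assms by (auto simp: D_sharp_le_iff)
    obtain X Y where "is_group_inverse ?A X" "is_group_inverse ?B Y"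
      using assms by (auto simp: dual_CM_def group_invertible_def)
    then have "MP_invertible (?B - ?A)"
      using AB inner_inverse_diff MP_invertible_dualI by blast
    then have ?DM
      using assms F G \<open>?D\<close> D by (auto simp: DM_sharp_le_def sharp_le_def group_invertible_def)
    \<comment> \<open>Multiply the dual equations in \<open>D\<close> by G, on the right for
      \<open>?R\<close> and on the left for \<open>?L\<close>.\<close>
    moreover have ?R ?L
      using \<open>?D\<close> unfolding GE D by (metis EG matrix_mul_assoc)+
    ultimately show "?DM \<and> ?R \<and> ?L"
      by blast
  next
    assume R: "?DM \<and> ?R \<and> ?L"
    then have EF: "E ** F = E ** E" "F ** E = E ** E"
      by (auto simp: DM_sharp_le_def sharp_le_def)
    let ?N = "mat 1 - E ** G"
    \<comment> \<open>The order on the standard parts places E - F in the block of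
      \<open>?N\<close>.\<close>
    have "E ** G ** (E - F) = 0" "(E - F) ** (E ** G) = 0"
      by (simp_all add: EG matrix_diff_ldistrib EF flip: matrix_mul_assoc)
        (simp add: EF matrix_diff_rdistrib matrix_mul_assoc flip: EG)
    then have NEF: "?N ** (E - F) = E - F" "(E - F) ** ?N = E - F"
      by (simp_all add: matrix_diff_rdistrib[of "mat 1"] matrix_diff_ldistrib[of _ "mat 1"])
    \<comment> \<open>Inserting \<open>?N\<close> next to E - F produces the vanishing block
      \<open>?N ** E0 ** ?N\<close>. Hence E0 (E - F) and (E - F) E0 are fixed by E G on the left
      and right.\<close>
    have "?N ** (E0 ** (E - F)) = 0" "(E - F) ** E0 ** ?N = 0"
      by (metis NEF N matrix_mul_assoc matrix_mult_zero)+
    then have 1: "E ** G ** (E0 ** (E - F)) = E0 ** (E - F)"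
      and 2: "(E - F) ** E0 ** (E ** G) = (E - F) ** E0"
      by (simp_all add: matrix_diff_rdistrib[of "mat 1"] matrix_diff_ldistrib[of _ "mat 1"])
    \<comment> \<open>With E = E E G the identity \<open>?L\<close> applies; the resulting factor E
      G is absorbed by \<open>1\<close>.\<close>
    have "E ** (F0 - E0) = E ** (E ** G ** (F0 - E0))"
      by (metis G'(1) matrix_mul_assoc)
    also have "\<dots> = E ** G ** (E0 ** (E - F))"
      using R GE by (metis matrix_mul_assoc)
    finally have L: "E ** (F0 - E0) = E0 ** (E - F)"
      by (simp only: 1)
    have "(F0 - E0) ** E = (F0 - E0) ** E ** G ** E"
      by (metis G'(2) EG matrix_mul_assoc)
    also have "\<dots> = (E - F) ** E0 ** (E ** G)"
      using R GE EG by (metis matrix_mul_assoc)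
    finally have "(F0 - E0) ** E = (E - F) ** E0"
      by (simp only: 2)
    with L EF show ?D
      unfolding D by simp
  qed
qed

end
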